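(* If $n\ge 2$ and $K\subset\mathbb{H}^n$ is a complete set of diameter $D>0$, then $$R(K)\le R(\Delta(D))\quad\text{and}\quad r(K)\ge D-R(\Delta(D)).$$ Furthermore, either $R(K)=R(\Delta(D))$ or $r(K)=D-R(\Delta(D))$ if and only if $K$ contains a congruent copy of $\Delta(D)$.
   Context: $\mathbb{H}^n$ is $n$-dimensional hyperbolic space with geodesic distance $d$, $B(z,r)=\{x:d(x,z)\le r\}$. A set $K\subseteq\mathbb{H}^n$ is complete if $\mathrm{diam}(K\cup\{y\})>\mathrm{diam}(K)$ for each $y\in\mathbb{H}^n\setminus K$. For a compact convex set $K$, $r(K)=\max\{r\ge0:\exists z\in\mathbb{H}^n,\ B(z,r)\subseteq K\}$ is the inradius and $R(K)=\min\{R\ge0:\exists z\in\mathbb{H}^n,\ K\subseteq B(z,R)\}$ is the circumradius. (Complete sets of diameter $D$ are compact and convex.) $\Delta(D)$ denotes a fixed regular $n$-dimensional simplex in $\mathbb{H}^n$ of edge length $D$. *)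

theory Defs
  imports "HOL-Analysis.Analysis"
begin

section \<open>Hyperbolic space\<close>

text \<open>The hyperboloid model: for an \<open>n\<close>-dimensional Euclidean space \<open>'a\<close>, the type
  \<open>'a hyperbolic\<close> is the upper sheet of the unit hyperboloid in \<open>'a \<times> real\<close>, that is,
  \<open>n\<close>-dimensional hyperbolic space of curvature \<open>-1\<close>.  The Minkowski form is taken with the sign
  that makes it positive on time-like vectors, so that \<open>cosh (dist x y) = mink x y\<close>.\<close>

definition mink :: "'a::euclidean_space \<times> real \<Rightarrow> 'a \<times> real \<Rightarrow> real" where
  "mink p q = snd p * snd q - fst p \<bullet> fst q"

typedef (overloaded) 'a hyperbolic =
  "{p :: 'a::euclidean_space \<times> real. mink p p = 1 \<and> snd p > 0}"
  morphisms hvec Abs_hyperbolic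
  by (rule exI[of _ "(0, 1)"]) (simp add: mink_def)

lemma hvec_self: "mink (hvec x) (hvec x) = 1"
  and hvec_pos: "snd (hvec x) > 0"
  using hvec[of x] by auto

lemma mink_commute: "mink p q = mink q p"
  by (simp add: mink_def inner_commute mult.commute)

lemma mink_diff_left: "mink (p - q) r = mink p r - mink q r"
  and mink_diff_right: "mink r (p - q) = mink r p - mink r q"
  and mink_scale_left: "mink (c *\<^sub>R p) r = c * mink p r"
  and mink_scale_right: "mink r (c *\<^sub>R p) = c * mink r p"
  by (simp_all add: mink_def algebra_simps inner_diff_left inner_diff_right)

lemma mink_gram_ge:
  assumes "mink p p = 1" "mink q q = 1"
  shows "(snd p * snd q)\<^sup>2 \<ge> (1 + fst p \<bullet> fst q)\<^sup>2 + (norm (fst p - fst q))\<^sup>2"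
proof -
  have 1: "(snd p)\<^sup>2 = 1 + fst p \<bullet> fst p" "(snd q)\<^sup>2 = 1 + fst q \<bullet> fst q"
    using assms by (simp_all add: mink_def power2_eq_square)
  have 2: "(fst p \<bullet> fst q)\<^sup>2 \<le> (fst p \<bullet> fst p) * (fst q \<bullet> fst q)"
    by (rule Cauchy_Schwarz_ineq)
  have 3: "(norm (fst p - fst q))\<^sup>2 = fst p \<bullet> fst p - 2 * (fst p \<bullet> fst q) + fst q \<bullet> fst q"
    by (simp add: power2_norm_eq_inner inner_diff_left inner_diff_right inner_commute)
  show ?thesis
    using 2 unfolding 3 power_mult_distrib 1
    by (simp add: power2_eq_square algebra_simps)
qed

lemma mink_hvec_ge_1: "mink (hvec x) (hvec y) \<ge> 1"
proof -
  have "(1 + fst (hvec x) \<bullet> fst (hvec y))\<^sup>2 \<le> (snd (hvec x) * snd (hvec y))\<^sup>2"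
    using mink_gram_ge[OF hvec_self[of x] hvec_self[of y]]
    by (smt (verit) zero_le_power2)
  hence "1 + fst (hvec x) \<bullet> fst (hvec y) \<le> snd (hvec x) * snd (hvec y)"
    by (rule power2_le_imp_le) (simp add: hvec_pos less_imp_le)
  thus ?thesis by (simp add: mink_def)
qed

lemma mink_hvec_eq_1_iff: "mink (hvec x) (hvec y) = 1 \<longleftrightarrow> x = y"
proof
  assume "mink (hvec x) (hvec y) = 1"
  hence "snd (hvec x) * snd (hvec y) = 1 + fst (hvec x) \<bullet> fst (hvec y)"
    by (simp add: mink_def)
  hence "(norm (fst (hvec x) - fst (hvec y)))\<^sup>2 \<le> 0"
    using mink_gram_ge[OF hvec_self[of x] hvec_self[of y]] by simp
  hence f: "fst (hvec x) = fst (hvec y)" by simp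
  have "(snd (hvec x))\<^sup>2 = (snd (hvec y))\<^sup>2"
    using hvec_self[of x] hvec_self[of y] f by (simp add: mink_def power2_eq_square)
  hence "snd (hvec x) = snd (hvec y)"
    using hvec_pos[of x] hvec_pos[of y] by (simp add: power2_eq_iff)
  with f show "x = y" by (metis hvec_inject prod_eqI)
qed (simp add: hvec_self)

lemma mink_orthogonal_nonpos:
  assumes y: "mink y y = 1" and u: "mink u y = 0"
  shows "mink u u \<le> 0" and "mink u u = 0 \<Longrightarrow> u = 0"
proof -
  define s where "s = snd u"
  define t where "t = snd y"
  have t2: "t\<^sup>2 = 1 + fst y \<bullet> fst y"
    using y by (simp add: mink_def t_def power2_eq_square)
  have st: "s * t = fst u \<bullet> fst y"
    using u by (simp add: mink_def s_def t_def)
  have cs: "s\<^sup>2 * t\<^sup>2 \<le> (fst u \<bullet> fst u) * (t\<^sup>2 - 1)"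
    using Cauchy_Schwarz_ineq[of "fst u" "fst y"] st t2
    by (metis add_diff_cancel_left' power_mult_distrib)
  have tp: "t\<^sup>2 > 0" using t2 by (smt (verit) inner_ge_zero)
  have key: "t\<^sup>2 * mink u u \<le> - (fst u \<bullet> fst u)"
    using cs by (simp add: mink_def s_def power2_eq_square algebra_simps)
  show "mink u u \<le> 0"
    using key tp by (smt (verit) inner_ge_zero mult_pos_pos)
  assume 0: "mink u u = 0"
  hence f: "fst u = 0" using key by (metis inner_ge_zero inner_eq_zero_iff
      mult_zero_right neg_0_le_iff_le order_antisym)
  hence "snd u = 0" using 0 by (simp add: mink_def)
  with f show "u = 0" by (simp add: prod_eq_iff)
qed

lemma mink_orthogonal_Cauchy_Schwarz:
  assumes y: "mink y y = 1" and u: "mink u y = 0" and w: "mink w y = 0"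
  shows "(mink u w)\<^sup>2 \<le> mink u u * mink w w"
proof (cases "mink w w = 0")
  case True
  hence "w = 0" using mink_orthogonal_nonpos(2)[OF y w] by simp
  thus ?thesis by (simp add: mink_def)
next
  case False
  hence neg: "mink w w < 0" using mink_orthogonal_nonpos(1)[OF y w] by simp
  define v where "v = mink w w *\<^sub>R u - mink u w *\<^sub>R w"
  have "mink v y = 0"
    by (simp add: v_def mink_diff_left mink_scale_left u w)
  hence "mink v v \<le> 0" by (rule mink_orthogonal_nonpos(1)[OF y])
  moreover have "mink v v = mink w w * (mink u u * mink w w - (mink u w)\<^sup>2)"
    by (simp add: v_def mink_diff_left mink_diff_right mink_scale_left mink_scale_right
        mink_commute[of w u] power2_eq_square algebra_simps)
  ultimately show ?thesis using neg by (simp add: mult_le_0_iff)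
qed

lemma mink_triangle:
  "mink (hvec x) (hvec z) \<le> cosh (arcosh (mink (hvec x) (hvec y)) + arcosh (mink (hvec y) (hvec z)))"
proof -
  define a b where "a = mink (hvec x) (hvec y)" and "b = mink (hvec y) (hvec z)"
  define u w where "u = hvec x - a *\<^sub>R hvec y" and "w = hvec z - b *\<^sub>R hvec y"
  have a1: "a \<ge> 1" and b1: "b \<ge> 1" by (simp_all add: a_def b_def mink_hvec_ge_1)
  note expand = mink_diff_left mink_diff_right mink_scale_left mink_scale_right hvec_self
  have zy: "mink (hvec z) (hvec y) = b" "mink (hvec y) (hvec x) = a"
    by (simp_all add: a_def b_def mink_commute)
  have "mink u (hvec y) = 0" "mink w (hvec y) = 0"
    by (simp_all add: u_def w_def expand zy flip: a_def)
  hence "(mink u w)\<^sup>2 \<le> mink u u * mink w w"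
    by (rule mink_orthogonal_Cauchy_Schwarz[OF hvec_self])
  moreover have "mink u u = 1 - a\<^sup>2" "mink w w = 1 - b\<^sup>2"
    and uw: "mink u w = mink (hvec x) (hvec z) - a * b"
    by (simp_all add: u_def w_def expand zy power2_eq_square algebra_simps flip: a_def b_def)
  ultimately have "(mink (hvec x) (hvec z) - a * b)\<^sup>2 \<le> (a\<^sup>2 - 1) * (b\<^sup>2 - 1)"
    by (simp add: algebra_simps)
  hence "mink (hvec x) (hvec z) - a * b \<le> sqrt (a\<^sup>2 - 1) * sqrt (b\<^sup>2 - 1)"
    by (metis real_le_rsqrt real_sqrt_mult)
  moreover have "cosh (arcosh a + arcosh b) = a * b + sqrt (a\<^sup>2 - 1) * sqrt (b\<^sup>2 - 1)"
    using a1 b1 by (simp add: cosh_add sinh_arcosh_real)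
  ultimately show ?thesis by (simp add: a_def b_def)
qed

instantiation hyperbolic :: (euclidean_space) metric_space
begin

definition dist_hyperbolic :: "'a hyperbolic \<Rightarrow> 'a hyperbolic \<Rightarrow> real" where
  "dist_hyperbolic x y = arcosh (mink (hvec x) (hvec y))"

definition uniformity_hyperbolic :: "('a hyperbolic \<times> 'a hyperbolic) filter" where
  "uniformity_hyperbolic = (INF e\<in>{0<..}. principal {(x, y :: 'a hyperbolic). dist x y < e})"

definition open_hyperbolic :: "'a hyperbolic set \<Rightarrow> bool" where
  "open_hyperbolic U = (\<forall>x\<in>U. \<forall>\<^sub>F (x', y) in uniformity. x' = x \<longrightarrow> y \<in> U)"

instance
proof
  fix x y z :: "'a hyperbolic"
  show "dist x y = 0 \<longleftrightarrow> x = y"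
    using mink_hvec_ge_1[of x y]
    by (metis arcosh_1 cosh_0 cosh_arcosh_real dist_hyperbolic_def mink_hvec_eq_1_iff)
  have "0 \<le> arcosh (mink (hvec x) (hvec z)) + arcosh (mink (hvec y) (hvec z))"
    by (simp add: mink_hvec_ge_1)
  moreover have "cosh (arcosh (mink (hvec x) (hvec y))) \<le>
      cosh (arcosh (mink (hvec x) (hvec z)) + arcosh (mink (hvec y) (hvec z)))"
    using mink_triangle[of x y z]
    by (simp add: mink_hvec_ge_1 mink_commute[of "hvec z" "hvec y"])
  ultimately show "dist x y \<le> dist x z + dist y z"
    unfolding dist_hyperbolic_def
    by (metis arcosh_nonneg_real cosh_real_nonneg_le_iff mink_hvec_ge_1)
qed (simp_all only: uniformity_hyperbolic_def open_hyperbolic_def)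

end

lemma cosh_dist_hyperbolic: "cosh (dist x y) = mink (hvec x) (hvec y)"
  by (simp add: dist_hyperbolic_def mink_hvec_ge_1)


section \<open>Complete sets, inradius and circumradius\<close>

text \<open>Completeness in the sense of diameters, not Cauchy completeness.  The constant
  \<^const>\<open>diameter\<close> is meaningful only for bounded sets, hence the first conjunct.\<close>

definition diam_complete :: "'a::metric_space set \<Rightarrow> bool" where
  "diam_complete K \<longleftrightarrow> bounded K \<and> (\<forall>y. y \<notin> K \<longrightarrow> diameter (K \<union> {y}) > diameter K)"

text \<open>As a maximum and a minimum these are meaningful for nonempty compact sets \<open>K\<close>.\<close>

definition inradius :: "'a::metric_space set \<Rightarrow> real" where
  "inradius K = (GREATEST r. r \<ge> 0 \<and> (\<exists>z. cball z r \<subseteq> K))"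

definition circumradius :: "'a::metric_space set \<Rightarrow> real" where
  "circumradius K = (LEAST R. R \<ge> 0 \<and> (\<exists>z. K \<subseteq> cball z R))"


section \<open>Regular simplices and congruence\<close>

text \<open>In hyperbolic space the points \<open>z\<close> with equality in the triangle inequality are exactly those
  of the unique geodesic segment from \<open>x\<close> to \<open>y\<close>.\<close>

definition geodesic_convex :: "'a::metric_space set \<Rightarrow> bool" where
  "geodesic_convex S \<longleftrightarrow> (\<forall>x\<in>S. \<forall>y\<in>S. {z. dist x z + dist z y = dist x y} \<subseteq> S)"

text \<open>A regular \<open>n\<close>-simplex is the convex hull of \<open>n + 1\<close> points with all mutual distances equal;
  for a positive edge length such points are automatically in general position.\<close>

definition regular_simplex :: "real \<Rightarrow> 'a::euclidean_space hyperbolic set \<Rightarrow> bool" where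
  "regular_simplex D T \<longleftrightarrow>
     (\<exists>V. finite V \<and> card V = DIM('a) + 1 \<and> (\<forall>x\<in>V. \<forall>y\<in>V. x \<noteq> y \<longrightarrow> dist x y = D) \<and>
          T = geodesic_convex hull V)"

definition isometric_image :: "'a::metric_space set \<Rightarrow> 'a set \<Rightarrow> bool" where
  "isometric_image S T \<longleftrightarrow>
     (\<exists>f. bij f \<and> (\<forall>x y. dist (f x) (f y) = dist x y) \<and> T = f ` S)"

lemma regular_simplex_exists:
  assumes "D > 0"
  shows "\<exists>T :: 'a::euclidean_space hyperbolic set. regular_simplex D T"
proof -
  define n where "n = real DIM('a)"
  have n: "n \<ge> 1" using DIM_positive[where 'a='a] unfolding n_def by linarith
  define k where "k = 1 / sqrt (n + 1)"
  define h where "h = (1 - k) / n"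
  define e :: 'a where "e = \<Sum>Basis"
  define s where "s = sqrt (cosh D - 1)"
  have s2: "s\<^sup>2 = cosh D - 1" by (simp add: s_def cosh_real_ge_1)
  have k2: "k\<^sup>2 = 1 / (n + 1)" using n by (simp add: k_def power_divide)
  have nh: "n * h = 1 - k" using n by (simp add: h_def)
  have hh: "n * h\<^sup>2 - 2 * h = - (k\<^sup>2)"
  proof -
    have "n * (n * h\<^sup>2 - 2 * h) = (n * h)\<^sup>2 - 2 * (n * h)"
      by (simp add: power2_eq_square algebra_simps)
    also have "\<dots> = k\<^sup>2 - 1" unfolding nh by (simp add: power2_eq_square algebra_simps)
    also have "\<dots> = n * (- (k\<^sup>2))" using n by (simp add: k2 field_simps)
    finally show ?thesis by (rule mult_left_cancel[THEN iffD1, rotated]) (use n in simp)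
  qed
  have eb: "e \<bullet> b = 1" "b \<bullet> e = 1" if "b \<in> Basis" for b
    using that by (simp_all add: e_def inner_sum_left inner_sum_right inner_Basis if_distrib
        cong: if_cong)
  have ee: "e \<bullet> e = n"
    by (subst (2) e_def) (simp add: inner_sum_right eb n_def)
  text \<open>The vertices are indexed by the basis vectors together with \<open>0\<close>.\<close>
  define v where "v = (\<lambda>b. if b = 0 then - k *\<^sub>R e else b - h *\<^sub>R e)"
  let ?I = "insert (0::'a) Basis"
  have I0: "(0::'a) \<notin> Basis" using nonzero_Basis by blast
  have vv: "v b \<bullet> v c = (if b = c then 1 else 0) - k\<^sup>2" if bc: "b \<in> ?I" "c \<in> ?I" for b c
  proof -
    have k1: "n * k\<^sup>2 = 1 - k\<^sup>2" using n by (simp add: k2 field_simps)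
    consider "b = 0" "c = 0" | "b = 0" "c \<in> Basis" | "b \<in> Basis" "c = 0"
      | "b \<in> Basis" "c \<in> Basis" using bc by auto
    thus ?thesis
    proof cases
      case 1
      thus ?thesis using k1 by (simp add: v_def ee power2_eq_square algebra_simps)
    next
      case 2
      have "v b \<bullet> v c = - k * (1 - n * h)"
        using 2 I0 by (auto simp: v_def inner_diff_right eb ee algebra_simps)
      thus ?thesis using 2 I0 by (auto simp: nh power2_eq_square)
    next
      case 3
      have "v b \<bullet> v c = - k * (1 - n * h)"
        using 3 I0 by (auto simp: v_def inner_diff_left eb ee algebra_simps)
      thus ?thesis using 3 I0 by (auto simp: nh power2_eq_square)
    next
      case 4
      have "b \<noteq> 0" "c \<noteq> 0" using 4 I0 by auto
      hence "v b \<bullet> v c = b \<bullet> c + (n * h\<^sup>2 - 2 * h)"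
        using 4 by (simp add: v_def inner_diff_left inner_diff_right eb ee power2_eq_square
            algebra_simps)
      thus ?thesis using 4 by (simp add: hh inner_Basis)
    qed
  qed
  define t where "t = sqrt (1 + s\<^sup>2 * (1 - k\<^sup>2))"
  have k21: "k\<^sup>2 \<le> 1" using n by (simp add: k2)
  have t2: "t * t = 1 + s\<^sup>2 * (1 - k\<^sup>2)"
    unfolding t_def using k21 by (simp add: add_nonneg_nonneg)
  have tpos: "t > 0" unfolding t_def using k21 by (simp add: add_pos_nonneg)
  define p where "p = (\<lambda>b. Abs_hyperbolic (s *\<^sub>R v b, t))"
  have hp: "hvec (p b) = (s *\<^sub>R v b, t)" if "b \<in> ?I" for b
    unfolding p_def using vv[OF that that]
    by (subst Abs_hyperbolic_inverse) (simp_all add: mink_def t2 tpos power2_eq_square)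
  have d: "dist (p b) (p c) = D" if "b \<in> ?I" "c \<in> ?I" "b \<noteq> c" for b c
  proof -
    have "cosh (dist (p b) (p c)) = cosh D"
      unfolding cosh_dist_hyperbolic hp[OF that(1)] hp[OF that(2)]
      using vv[OF that(1,2)] that(3) s2
      by (simp add: mink_def t2 power2_eq_square algebra_simps)
    thus ?thesis using assms by (metis arcosh_cosh_real less_imp_le zero_le_dist)
  qed
  have inj: "inj_on p ?I"
    using d assms by (metis (no_types, lifting) dist_self inj_onI less_irrefl)
  have "card (p ` ?I) = DIM('a) + 1"
    using I0 by (simp only: card_image[OF inj]) simp
  moreover have "\<forall>x\<in>p ` ?I. \<forall>y\<in>p ` ?I. x \<noteq> y \<longrightarrow> dist x y = D"
    using d by blast
  ultimately show ?thesis
    unfolding regular_simplex_def by (metis finite_Basis finite_imageI finite_insert)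
qed

end

theory Submission
  imports Defs
begin

text \<open>Write \<open>R\<close> and \<open>r\<close> for circumradius and inradius. A complete set \<open>K\<close> of diameter \<open>D\<close> is the
  intersection of the balls of radius \<open>D\<close> about its points (\<open>diam_complete_iff_cball\<close>). As geodesics
  can be prolonged, the ball of radius \<open>r\<close> about \<open>z\<close> lies in \<open>K\<close> if and only if \<open>K\<close> lies in the ball
  of radius \<open>D - r\<close> about \<open>z\<close> (\<open>cball_subset_complete_iff\<close>). Hence \<open>r(K) = D - R(K)\<close>, and
  everything reduces to Jung's theorem for \<open>R(K)\<close> with its case of equality.

  Jung's theorem is proved by linear algebra in the ambient space of the hyperboloid. Let \<open>q\<close> maximise
  the quadratic form \<open>mink q q\<close> over the convex hull of \<open>K\<close>, and write \<open>q = C z\<close> with \<open>z\<close> on the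
  hyperboloid. The first-order condition at \<open>q\<close> is \<open>mink z x \<le> C\<close> for all \<open>x\<close> in \<open>K\<close>, so the ball of
  radius \<open>arcosh C\<close> about \<open>z\<close> covers \<open>K\<close>, and \<open>q\<close> is a convex combination of points \<open>t\<close> of \<open>K\<close> with
  \<open>mink z t = C\<close>; these lie on a hyperplane, so by Caratheodory's theorem \<open>n + 1\<close> of them suffice
  (\<open>ex_circumcentre\<close>). Pairing the convex combination with an arbitrary point of the hyperboloid shows
  that no smaller ball covers \<open>K\<close> (\<open>covering_radius_ge\<close>); pairing it with the points \<open>t\<close> themselves and
  adding up gives \<open>C\<^sup>2 \<le> (1 + n cosh D) / (n + 1)\<close>, with equality only if there are \<open>n + 1\<close> points
  with all mutual distances equal to \<open>D\<close> (\<open>jung_bound\<close>).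

  For a regular simplex the normalised centroid is the circumcentre and equality holds
  (\<open>ex_centre_simplex\<close>). Finally, any two regular simplices of edge length \<open>D\<close> are congruent
  (\<open>ex_isometry_simplices\<close>), and \<open>K\<close>, being an intersection of balls, contains the geodesic hull
  of each of its subsets.\<close>


section \<open>The Minkowski form\<close>

lemma mink_add_left: "mink (p + q) r = mink p r + mink q r"
  and mink_add_right: "mink r (p + q) = mink r p + mink r q"
  and mink_minus_left: "mink (- p) r = - mink p r"
  by (simp_all add: mink_def algebra_simps inner_add_left inner_add_right)

lemma mink_0_left [simp]: "mink 0 r = 0"
  by (simp add: mink_def)

lemma mink_sum_left: "mink (\<Sum>i\<in>I. f i) r = (\<Sum>i\<in>I. mink (f i) r)"
  by (induction I rule: infinite_finite_induct) (simp_all add: mink_add_left)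

lemma mink_sum_right: "mink r (\<Sum>i\<in>I. f i) = (\<Sum>i\<in>I. mink r (f i))"
  by (simp add: mink_sum_left mink_commute[of r])

lemmas mink_linear = mink_add_left mink_add_right mink_diff_left mink_diff_right
  mink_scale_left mink_scale_right mink_sum_left mink_sum_right

lemma mink_eq_inner: "mink q p = (- fst q, snd q) \<bullet> p"
  by (cases p) (simp add: mink_def)

lemma continuous_on_mink [continuous_intros]:
  assumes "continuous_on S f" "continuous_on S g"
  shows "continuous_on S (\<lambda>x. mink (f x) (g x))"
  unfolding mink_def by (intro continuous_intros assms)

lemma dist_eq_iff_mink:
  assumes "D \<ge> 0"
  shows "dist x y = D \<longleftrightarrow> mink (hvec x) (hvec y) = cosh D"
  unfolding cosh_dist_hyperbolic[symmetric] using assms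
  by (metis arcosh_cosh_real zero_le_dist)

lemma dist_le_iff_mink:
  assumes "D \<ge> 0"
  shows "dist x y \<le> D \<longleftrightarrow> mink (hvec x) (hvec y) \<le> cosh D"
  unfolding cosh_dist_hyperbolic[symmetric] using assms
  by (simp add: cosh_real_nonneg_le_iff)

lemma hvec_Abs:
  assumes "mink p p = 1" "snd p > 0"
  shows "hvec (Abs_hyperbolic p) = p"
  using assms by (intro Abs_hyperbolic_inverse) simp

lemma snd_nonzero_if_unit:
  assumes "mink p p = 1"
  shows "snd p \<noteq> 0"
proof
  assume "snd p = 0"
  hence "fst p \<bullet> fst p = - 1" using assms by (simp add: mink_def)
  moreover have "fst p \<bullet> fst p \<ge> 0" by simp
  ultimately show False by linarith
qed

text \<open>A unit time-like vector that pairs positively with a point of the upper sheet lies on the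
  upper sheet itself.\<close>

lemma hvec_surj:
  assumes p: "mink p p = 1" and pos: "mink p (hvec x) > 0"
  shows "\<exists>y. hvec y = p"
proof -
  have "snd p > 0"
  proof (rule ccontr)
    assume "\<not> snd p > 0"
    moreover have "snd p \<noteq> 0"
      using snd_nonzero_if_unit[OF p] .
    ultimately have "hvec (Abs_hyperbolic (- p)) = - p"
      using p by (intro hvec_Abs) (auto simp: mink_def)
    hence "mink (- p) (hvec x) \<ge> 1" using mink_hvec_ge_1[of "Abs_hyperbolic (- p)" x] by simp
    thus False using pos by (simp add: mink_minus_left)
  qed
  with p show ?thesis using hvec_Abs by blast
qed


section \<open>Geodesics and balls\<close>

text \<open>A point of the segment from \<open>x\<close> to \<open>y\<close> is a nonnegative linear combination of \<open>x\<close> and \<open>y\<close>;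
  the coefficients are the usual ratios of hyperbolic sines.\<close>

lemma hvec_between:
  assumes xy: "x \<noteq> y" and z: "dist x z + dist z y = dist x y"
  shows "\<exists>a b. a \<ge> 0 \<and> b \<ge> 0 \<and> hvec z = a *\<^sub>R hvec x + b *\<^sub>R hvec y"
proof -
  define s t d where "s = dist x z" and "t = dist z y" and "d = dist x y"
  have st: "d = s + t" using z by (simp add: s_def t_def d_def)
  have nn: "s \<ge> 0" "t \<ge> 0" "d > 0" using xy by (simp_all add: s_def t_def d_def)
  hence sd: "sinh d > 0" by simp
  define a b where "a = sinh t / sinh d" and "b = sinh s / sinh d"
  have m: "mink (hvec x) (hvec y) = cosh d" "mink (hvec y) (hvec x) = cosh d"
    "mink (hvec x) (hvec z) = cosh s" "mink (hvec z) (hvec x) = cosh s"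
    "mink (hvec y) (hvec z) = cosh t" "mink (hvec z) (hvec y) = cosh t"
    by (simp_all add: s_def t_def d_def flip: cosh_dist_hyperbolic)
      (simp_all add: dist_commute)
  \<comment> \<open>\<open>u\<close> is orthogonal to \<open>x\<close> and \<open>y\<close> and isotropic, hence zero.\<close>
  define u where "u = hvec z - a *\<^sub>R hvec x - b *\<^sub>R hvec y"
  have "sinh (d - s) = sinh t" "sinh (d - t) = sinh s" by (simp_all add: st)
  hence h: "sinh t + sinh s * cosh d = sinh d * cosh s"
    "sinh t * cosh d + sinh s = sinh d * cosh t"
    by (simp_all add: sinh_diff mult.commute)
  have ux: "mink u (hvec x) = 0" and uy: "mink u (hvec y) = 0"
    using h sd by (simp_all add: u_def mink_linear m hvec_self a_def b_def field_simps)
  have "mink u u = mink u (hvec z)"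
    using ux uy by (subst (2) u_def) (simp add: mink_linear)
  also have "\<dots> = 1 - (sinh t * cosh s + sinh s * cosh t) / sinh d"
    by (simp add: u_def mink_linear m hvec_self a_def b_def add_divide_distrib)
  also have "sinh t * cosh s + sinh s * cosh t = sinh d"
    by (simp add: st sinh_add)
  finally have "mink u u = 0" using sd by simp
  hence "u = 0" by (rule mink_orthogonal_nonpos(2)[OF hvec_self ux])
  hence "hvec z = a *\<^sub>R hvec x + b *\<^sub>R hvec y" by (simp add: u_def algebra_simps)
  moreover have "a \<ge> 0" "b \<ge> 0" using nn sd by (simp_all add: a_def b_def)
  ultimately show ?thesis by blast
qed

lemma geodesic_convex_cball:
  "geodesic_convex (cball (w :: 'a::euclidean_space hyperbolic) r)"
  unfolding geodesic_convex_def
proof (intro ballI subsetI)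
  fix x y z :: "'a hyperbolic"
  assume x: "x \<in> cball w r" and y: "y \<in> cball w r"
    and "z \<in> {z. dist x z + dist z y = dist x y}"
  hence z: "dist x z + dist z y = dist x y" by simp
  show "z \<in> cball w r"
  proof (cases "x = y")
    case True
    thus ?thesis using z x by (simp add: dist_commute)
  next
    case False
    then obtain a b where ab: "a \<ge> 0" "b \<ge> 0" and eq: "hvec z = a *\<^sub>R hvec x + b *\<^sub>R hvec y"
      using hvec_between z by blast
    have r: "r \<ge> 0" using x zero_le_dist[of w x] by (simp del: zero_le_dist)
    have "(a + b)\<^sup>2 + 2 * a * b * (mink (hvec x) (hvec y) - 1) = mink (hvec z) (hvec z)"
      unfolding eq
      by (simp add: mink_linear hvec_self mink_commute[of "hvec y" "hvec x"]
          power2_eq_square algebra_simps)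
    moreover have "2 * a * b * (mink (hvec x) (hvec y) - 1) \<ge> 0"
      using ab mink_hvec_ge_1[of x y] by simp
    ultimately have "(a + b)\<^sup>2 \<le> 1\<^sup>2" by (simp add: hvec_self)
    hence 1: "a + b \<le> 1" by (rule power2_le_imp_le) simp
    have "mink (hvec w) (hvec z) = a * mink (hvec w) (hvec x) + b * mink (hvec w) (hvec y)"
      by (simp add: eq mink_linear)
    also have "\<dots> \<le> a * cosh r + b * cosh r"
      using x y r ab by (intro add_mono mult_left_mono) (simp_all add: dist_le_iff_mink)
    also have "\<dots> = (a + b) * cosh r" by (simp add: algebra_simps)
    also have "\<dots> \<le> 1 * cosh r" using 1 by (intro mult_right_mono) simp_all
    finally show ?thesis using r by (simp add: dist_le_iff_mink)
  qed
qed

lemma geodesic_convex_Inter: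
  assumes "\<And>S. S \<in> F \<Longrightarrow> geodesic_convex S"
  shows "geodesic_convex (\<Inter>F)"
  using assms unfolding geodesic_convex_def by blast

lemma geodesic_extension:
  fixes x z :: "'a::euclidean_space hyperbolic"
  assumes "x \<noteq> z" "r \<ge> 0"
  shows "\<exists>y. dist z y = r \<and> dist x y = dist x z + r"
proof -
  define s where "s = dist x z"
  have s: "s > 0" using assms by (simp add: s_def)
  hence ss: "sinh s > 0" by simp
  have m: "mink (hvec x) (hvec z) = cosh s" "mink (hvec z) (hvec x) = cosh s"
    by (simp_all add: s_def flip: cosh_dist_hyperbolic) (simp add: dist_commute)
  \<comment> \<open>The unit tangent vector at \<open>z\<close> pointing away from \<open>x\<close>.\<close>
  define u where "u = (1 / sinh s) *\<^sub>R (cosh s *\<^sub>R hvec z - hvec x)"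
  define p where "p = cosh r *\<^sub>R hvec z + sinh r *\<^sub>R u"
  have c2: "cosh s * cosh s = 1 + sinh s * sinh s" "cosh r * cosh r = 1 + sinh r * sinh r"
    using cosh_square_eq[of s] cosh_square_eq[of r] by (simp_all add: power2_eq_square)
  have uz: "mink u (hvec z) = 0" "mink (hvec z) u = 0"
    by (simp_all add: u_def mink_linear m hvec_self)
  have ux: "mink (hvec x) u = sinh s"
    using ss by (simp add: u_def mink_linear m hvec_self c2)
  have uu: "mink u u = - 1"
    using ss by (subst (2) u_def) (simp add: mink_linear uz mink_commute[of u "hvec x"] ux)
  have pp: "mink p p = 1"
    by (simp add: p_def mink_linear uz uu hvec_self c2)
  have pz: "mink (hvec z) p = cosh r"
    by (simp add: p_def mink_linear uz hvec_self)
  have px: "mink (hvec x) p = cosh (s + r)"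
    by (simp add: p_def mink_linear ux m cosh_add)
  obtain y where "hvec y = p"
    using hvec_surj[OF pp, of z] pz by (auto simp: mink_commute)
  thus ?thesis
    using pz px s assms
    by (intro exI[of _ y]) (simp add: dist_eq_iff_mink flip: s_def)
qed


section \<open>Complete sets\<close>

text \<open>The spherical intersection property.\<close>

lemma diam_complete_iff_cball:
  assumes K: "diam_complete K" and D: "diameter K = D" "D > 0"
  shows "y \<in> K \<longleftrightarrow> (\<forall>x\<in>K. dist x y \<le> D)"
proof
  have bd: "bounded K" using K by (simp add: diam_complete_def)
  assume "y \<in> K"
  thus "\<forall>x\<in>K. dist x y \<le> D" using bd D diameter_bounded_bound by blast
next
  have bd: "bounded K" using K by (simp add: diam_complete_def)
  assume y: "\<forall>x\<in>K. dist x y \<le> D"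
  have "diameter (K \<union> {y}) \<le> D"
  proof -
    have "dist a b \<le> D" if "a \<in> K \<union> {y}" "b \<in> K \<union> {y}" for a b
      using that y D diameter_bounded_bound[OF bd, of a b] by (auto simp: dist_commute)
    hence "(SUP (a, b)\<in>(K \<union> {y}) \<times> (K \<union> {y}). dist a b) \<le> D"
      by (intro cSUP_least) auto
    thus ?thesis by (simp add: diameter_def)
  qed
  thus "y \<in> K" using K D unfolding diam_complete_def by fastforce
qed

lemma diam_complete_eq_Inter:
  assumes K: "diam_complete K" and D: "diameter K = D" "D > 0"
  shows "K = (\<Inter>x\<in>K. cball x D)"
proof (rule set_eqI)
  show "y \<in> K \<longleftrightarrow> y \<in> (\<Inter>x\<in>K. cball x D)" for y
    unfolding diam_complete_iff_cball[OF assms, of y] by simp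
qed

lemma ex_two_points:
  assumes "diameter K \<noteq> 0"
  shows "\<exists>x\<in>K. x \<noteq> z"
proof (rule ccontr)
  assume "\<not> ?thesis"
  hence "K = {} \<or> K = {z}" by auto
  thus False using assms by (auto simp: diameter_def)
qed

text \<open>Inscribed and circumscribed balls of a complete set with a common centre correspond to each
  other: since geodesics can be prolonged, a ball lies in \<open>cball x D\<close> precisely when the distance of
  the centres plus its radius is at most \<open>D\<close>.\<close>

lemma cball_subset_complete_iff:
  fixes K :: "'a::euclidean_space hyperbolic set"
  assumes K: "diam_complete K" and D: "diameter K = D" "D > 0" and r: "r \<ge> 0"
  shows "cball z r \<subseteq> K \<longleftrightarrow> K \<subseteq> cball z (D - r)"
proof
  assume sub: "cball z r \<subseteq> K"
  have ne: "dist z x + r \<le> D" if x: "x \<in> K" "x \<noteq> z" for x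
  proof -
    obtain y where "dist z y = r" "dist x y = dist x z + r"
      using geodesic_extension[OF x(2) r] by blast
    moreover from this have "y \<in> K" using sub by auto
    ultimately show ?thesis
      using x diam_complete_iff_cball[OF K D, of y] by (auto simp: dist_commute)
  qed
  \<comment> \<open>If \<open>z\<close> belongs to \<open>K\<close>, the bound for \<open>x = z\<close> reads \<open>r \<le> D\<close>; it follows from that for any other point
    of \<open>K\<close>.\<close>
  obtain x0 where x0: "x0 \<in> K" "x0 \<noteq> z" using ex_two_points[of K z] D by auto
  have "r \<le> D" using ne[OF x0] zero_le_dist[of z x0] by linarith
  thus "K \<subseteq> cball z (D - r)" using ne by (force simp: algebra_simps)
next
  assume sub: "K \<subseteq> cball z (D - r)"
  show "cball z r \<subseteq> K"
  proof
    fix y assume y: "y \<in> cball z r"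
    have "dist x y \<le> D" if "x \<in> K" for x
    proof -
      have "dist z x \<le> D - r" "dist z y \<le> r" using sub that y by auto
      thus ?thesis using dist_triangle2[of x y z] by (simp add: dist_commute)
    qed
    thus "y \<in> K" using diam_complete_iff_cball[OF K D] by blast
  qed
qed

text \<open>Since \<open>hvec x\<close> is time-like, its pairing with \<open>hvec y\<close> is at least a positive multiple \<open>e\<close> of the
  height of \<open>hvec y\<close>, and the height controls the norm on the upper sheet.\<close>

lemma bounded_hvec_cball: "bounded (hvec ` cball x r)"
proof -
  define e where "e = snd (hvec x) - norm (fst (hvec x))"
  have norm: "norm (fst (hvec y)) \<le> snd (hvec y)" for y :: "'a hyperbolic"
  proof (rule power2_le_imp_le)
    show "(norm (fst (hvec y)))\<^sup>2 \<le> (snd (hvec y))\<^sup>2"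
      using hvec_self[of y] by (simp add: mink_def power2_norm_eq_inner) (simp add: power2_eq_square)
  qed (simp add: hvec_pos less_imp_le)
  have "(norm (fst (hvec x)))\<^sup>2 < (snd (hvec x))\<^sup>2"
    using hvec_self[of x] by (simp add: mink_def power2_norm_eq_inner) (simp add: power2_eq_square)
  hence "norm (fst (hvec x)) < snd (hvec x)"
    by (rule power2_less_imp_less) (simp add: hvec_pos less_imp_le)
  hence e: "e > 0" by (simp add: e_def)
  have "norm (hvec y) \<le> 2 * (cosh r / e)" if y: "dist x y \<le> r" for y
  proof -
    have r: "r \<ge> 0" using y zero_le_dist[of x y] by linarith
    have "fst (hvec x) \<bullet> fst (hvec y) \<le> norm (fst (hvec x)) * norm (fst (hvec y))"
      by (rule norm_cauchy_schwarz)
    also have "\<dots> \<le> norm (fst (hvec x)) * snd (hvec y)"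
      by (intro mult_left_mono norm) simp
    finally have "e * snd (hvec y) \<le> mink (hvec x) (hvec y)"
      by (simp add: e_def mink_def algebra_simps)
    also have "\<dots> \<le> cosh r" using y r by (simp add: dist_le_iff_mink)
    finally have "snd (hvec y) \<le> cosh r / e" using e by (simp add: field_simps)
    moreover have "norm (hvec y) \<le> norm (fst (hvec y)) + norm (snd (hvec y))"
      using norm_Pair_le[of "fst (hvec y)" "snd (hvec y)"] by simp
    ultimately show ?thesis using norm[of y] hvec_pos[of y] by simp
  qed
  hence "\<forall>p\<in>hvec ` cball x r. norm p \<le> 2 * (cosh r / e)" by auto
  thus ?thesis unfolding bounded_iff by blast
qed

lemma compact_hvec_complete:
  assumes K: "diam_complete K" and D: "diameter K = D" "D > 0"
  shows "compact (hvec ` K)"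
proof -
  obtain x0 where x0: "x0 \<in> K" using ex_two_points[of K] D by fastforce
  have "hvec ` K = {p. mink p p = 1} \<inter> {p. snd p \<ge> 0} \<inter> (\<Inter>x\<in>K. {p. mink (hvec x) p \<le> cosh D})"
    (is "_ = ?C")
  proof (intro equalityI subsetI)
    fix p assume "p \<in> hvec ` K"
    then obtain y where y: "y \<in> K" "p = hvec y" by blast
    hence "\<forall>x\<in>K. dist x y \<le> D" using diam_complete_iff_cball[OF K D] by blast
    hence "\<forall>x\<in>K. mink (hvec x) p \<le> cosh D" using D by (simp add: y dist_le_iff_mink)
    thus "p \<in> ?C" using hvec_pos[of y] by (simp add: y hvec_self)
  next
    fix p assume p: "p \<in> ?C"
    have "snd p \<noteq> 0" using p snd_nonzero_if_unit by blast
    hence "hvec (Abs_hyperbolic p) = p" using p by (intro hvec_Abs) auto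
    then obtain y where y: "p = hvec y" by metis
    hence "y \<in> K" using p D diam_complete_iff_cball[OF K D, of y] by (auto simp: dist_le_iff_mink)
    thus "p \<in> hvec ` K" using y by blast
  qed
  moreover have "closed ?C"
    by (intro closed_Int closed_INT ballI closed_Collect_eq closed_Collect_le continuous_intros)
  moreover have "bounded (hvec ` K)"
  proof (rule bounded_subset[OF bounded_hvec_cball])
    have "K \<subseteq> cball x0 D"
      by (subst diam_complete_eq_Inter[OF K D]) (use x0 in blast)
    thus "hvec ` K \<subseteq> hvec ` cball x0 D" by (rule image_mono)
  qed
  ultimately show ?thesis by (simp add: compact_eq_bounded_closed)
qed


section \<open>The circumcentre\<close>

text \<open>The weighted average of \<open>mink (hvec w) (hvec t)\<close> over \<open>t\<close> in \<open>T\<close> equals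
  \<open>C * mink (hvec w) (hvec z)\<close>, which is at least \<open>C\<close>, so some \<open>t\<close> is at distance at least
  \<open>arcosh C\<close> from \<open>w\<close>.\<close>

lemma covering_radius_ge:
  assumes T: "finite T" "T \<subseteq> cball w R" and l: "\<And>t. t \<in> T \<Longrightarrow> l t \<ge> 0" "sum l T = 1"
    and C: "C \<ge> 1" and eq: "(\<Sum>t\<in>T. l t *\<^sub>R hvec t) = C *\<^sub>R hvec z"
  shows "arcosh C \<le> R"
proof -
  have "T \<noteq> {}" using l by auto
  then obtain t0 where "t0 \<in> T" by blast
  hence "dist w t0 \<le> R" using T by auto
  hence R: "R \<ge> 0" using zero_le_dist[of w t0] by linarith
  have "C * 1 \<le> C * mink (hvec w) (hvec z)"
    using C mink_hvec_ge_1[of w z] by (intro mult_left_mono) auto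
  also have "\<dots> = mink (hvec w) (\<Sum>t\<in>T. l t *\<^sub>R hvec t)" by (simp add: eq mink_linear)
  also have "\<dots> = (\<Sum>t\<in>T. l t * mink (hvec w) (hvec t))" by (simp add: mink_linear)
  also have "\<dots> \<le> (\<Sum>t\<in>T. l t * cosh R)"
    using l T R by (intro sum_mono mult_left_mono) (auto simp flip: dist_le_iff_mink)
  also have "\<dots> = cosh R" by (simp add: l flip: sum_distrib_right)
  finally have "cosh (arcosh C) \<le> cosh R" using C by simp
  thus ?thesis using C R by (subst (asm) cosh_real_nonneg_le_iff) auto
qed

lemma circumradius_eqI:
  assumes T: "finite T" "T \<subseteq> K" and l: "\<And>t. t \<in> T \<Longrightarrow> l t \<ge> 0" "sum l T = 1"
    and C: "C \<ge> 1" and eq: "(\<Sum>t\<in>T. l t *\<^sub>R hvec t) = C *\<^sub>R hvec z"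
    and cov: "K \<subseteq> cball z (arcosh C)"
  shows "circumradius K = arcosh C"
  unfolding circumradius_def
proof (rule Least_equality)
  show "arcosh C \<ge> 0 \<and> (\<exists>z. K \<subseteq> cball z (arcosh C))" using C cov by auto
next
  fix R assume "R \<ge> 0 \<and> (\<exists>z. K \<subseteq> cball z R)"
  then obtain w where "T \<subseteq> cball w R" using T by blast
  thus "arcosh C \<le> R" using covering_radius_ge T l C eq by blast
qed

text \<open>The circumcentre is the normalisation of the point at which the quadratic form is maximal on the
  convex hull of \<open>K\<close> in the ambient linear space.\<close>

lemma ex_circumcentre:
  fixes K :: "'a::euclidean_space hyperbolic set"
  assumes ne: "K \<noteq> {}" and cpt: "compact (hvec ` K)"
  obtains z C T l where "C \<ge> 1" "finite T" "T \<subseteq> K" "card T \<le> DIM('a) + 1"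
    "\<And>t. t \<in> T \<Longrightarrow> l t \<ge> 0" "sum l T = 1" "(\<Sum>t\<in>T. l t *\<^sub>R hvec t) = C *\<^sub>R hvec z"
    "\<And>t. t \<in> T \<Longrightarrow> mink (hvec z) (hvec t) = C"
    "\<And>x. x \<in> K \<Longrightarrow> mink (hvec z) (hvec x) \<le> C"
proof -
  define P where "P = hvec ` K"
  have "compact (convex hull P)" using cpt by (simp add: P_def compact_convex_hull)
  moreover have "convex hull P \<noteq> {}" using ne by (simp add: P_def)
  ultimately have "\<exists>q\<in>convex hull P. \<forall>p\<in>convex hull P. mink p p \<le> mink q q"
    by (intro continuous_attains_sup continuous_intros)
  then obtain q where q: "q \<in> convex hull P" and max: "\<And>p. p \<in> convex hull P \<Longrightarrow> mink p p \<le> mink q q"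
    by blast
  define C where "C = sqrt (mink q q)"
  obtain x0 where "x0 \<in> K" using ne by blast
  hence "1 \<le> mink q q"
    using max[of "hvec x0"] hull_subset[of P convex] by (auto simp: P_def hvec_self)
  hence C1: "C \<ge> 1" and CC: "mink q q = C * C" by (simp_all add: C_def)
  have "convex {p::'a \<times> real. snd p > 0}"
    using convex_halfspace_gt[of 0 "(0, 1) :: 'a \<times> real"] by (simp add: inner_prod_def)
  hence "convex hull P \<subseteq> {p. snd p > 0}"
    by (intro hull_minimal) (auto simp: P_def hvec_pos)
  hence "snd q > 0" using q by blast
  hence "hvec (Abs_hyperbolic ((1 / C) *\<^sub>R q)) = (1 / C) *\<^sub>R q"
    using C1 CC by (intro hvec_Abs) (simp_all add: mink_linear)
  then obtain z where "hvec z = (1 / C) *\<^sub>R q" by blast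
  hence qz: "q = C *\<^sub>R hvec z" using C1 by simp

  \<comment> \<open>The first-order condition at the maximum.\<close>
  have first: "mink q p \<le> C * C" if p: "p \<in> P" for p
  proof (rule ccontr)
    assume neg: "\<not> mink q p \<le> C * C"
    define a b where "a = mink q (p - q)" and "b = mink (p - q) (p - q)"
    have a: "a > 0" using neg by (simp add: a_def mink_linear CC)
    \<comment> \<open>A step from \<open>q\<close> towards \<open>p\<close> so short that the linear term \<open>2 * t * a\<close> dominates the quadratic
      term \<open>t\<^sup>2 * b\<close>.\<close>
    define t where "t = min 1 (a / (\<bar>b\<bar> + 1))"
    have t: "0 < t" "t \<le> 1" using a by (simp_all add: t_def)
    have "t \<le> a / (\<bar>b\<bar> + 1)" by (simp add: t_def)
    hence "t * (\<bar>b\<bar> + 1) \<le> a" by (simp add: pos_le_divide_eq)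
    hence "\<bar>t * b\<bar> < a" using t by (simp add: abs_mult algebra_simps)
    hence tb: "- a < t * b" by linarith
    have "(1 - t) *\<^sub>R q + t *\<^sub>R p \<in> convex hull P"
      using t q hull_inc[of p P convex] p
      by (intro convexD_alt) auto
    moreover have "(1 - t) *\<^sub>R q + t *\<^sub>R p = q + t *\<^sub>R (p - q)" by (simp add: algebra_simps)
    ultimately have "mink (q + t *\<^sub>R (p - q)) (q + t *\<^sub>R (p - q)) \<le> mink q q" using max by metis
    moreover have "mink (q + t *\<^sub>R (p - q)) (q + t *\<^sub>R (p - q)) = mink q q + t * (2 * a + t * b)"
      unfolding a_def b_def
      by (simp only: mink_add_left mink_add_right mink_scale_left mink_scale_right
          mink_commute[of "p - q" q]) (simp add: algebra_simps)
    ultimately have "t * (2 * a + t * b) \<le> 0" by simp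
    thus False using t tb a by (simp add: mult_le_0_iff)
  qed

  \<comment> \<open>Only points of the supporting hyperplane contribute to \<open>q\<close>, so Caratheodory's theorem applies
    in one dimension less than that of the ambient space.\<close>
  define F where "F = P \<inter> {p. mink q p = C * C}"
  have "q \<in> convex hull F"
  proof -
    obtain S u where S: "finite S" "S \<subseteq> P" "\<And>s. s \<in> S \<Longrightarrow> u s \<ge> 0" "sum u S = 1"
      "(\<Sum>s\<in>S. u s *\<^sub>R s) = q"
      using q by (auto simp: convex_hull_explicit)
    have "(\<Sum>s\<in>S. u s * (C * C - mink q s)) = sum u S * (C * C) - mink q (\<Sum>s\<in>S. u s *\<^sub>R s)"
      by (simp add: mink_linear right_diff_distrib sum_subtractf sum_distrib_right)
    also have "\<dots> = 0" by (simp add: S CC)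
    finally have "\<forall>s\<in>S. u s * (C * C - mink q s) = 0"
      using S first by (subst (asm) sum_nonneg_eq_0_iff) (auto intro!: mult_nonneg_nonneg)
    hence zero: "u s = 0" if "s \<in> S - F" for s using that S by (auto simp: F_def)
    have "sum u (S \<inter> F) = 1" "(\<Sum>s\<in>S \<inter> F. u s *\<^sub>R s) = q"
      using sum.mono_neutral_left[of S "S \<inter> F" u] zero
        sum.mono_neutral_left[of S "S \<inter> F" "\<lambda>s. u s *\<^sub>R s"] S by auto
    thus ?thesis using S unfolding convex_hull_explicit
      by (intro CollectI exI[of _ "S \<inter> F"] exI[of _ u]) auto
  qed
  then obtain S where S: "finite S" "S \<subseteq> F" "card S \<le> aff_dim F + 1" "q \<in> convex hull S"
    unfolding caratheodory_aff_dim[of F] by blast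
  have "aff_dim F \<le> aff_dim {p. (- fst q, snd q) \<bullet> p = C * C}"
    by (intro aff_dim_subset) (auto simp: F_def mink_eq_inner)
  also have "\<dots> = DIM('a \<times> real) - 1"
    using \<open>snd q > 0\<close> by (intro aff_dim_hyperplane) (auto simp: zero_prod_def)
  finally have cS: "card S \<le> DIM('a) + 1" using S by simp
  obtain u where u: "\<And>s. s \<in> S \<Longrightarrow> u s \<ge> 0" "sum u S = 1" "(\<Sum>s\<in>S. u s *\<^sub>R s) = q"
    using S by (auto simp: convex_hull_finite)
  have inj: "inj_on hvec T" for T :: "'a hyperbolic set" by (simp add: inj_on_def hvec_inject)
  obtain T where T: "T \<subseteq> K" "S = hvec ` T"
    using S by (auto simp: F_def P_def subset_image_iff)
  show ?thesis
  proof (rule that[of C T "\<lambda>t. u (hvec t)" z])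
    show "finite T" "card T \<le> DIM('a) + 1"
      using S cS unfolding T by (simp_all add: finite_image_iff inj card_image)
    show "(\<Sum>t\<in>T. u (hvec t)) = 1" "(\<Sum>t\<in>T. u (hvec t) *\<^sub>R hvec t) = C *\<^sub>R hvec z"
      using u unfolding T by (simp_all add: sum.reindex inj qz)
    show "mink (hvec z) (hvec t) = C" if "t \<in> T" for t
      using that S C1 unfolding T by (auto simp: F_def qz mink_linear)
    show "mink (hvec z) (hvec x) \<le> C" if "x \<in> K" for x
      using that first[of "hvec x"] C1 by (auto simp: P_def qz mink_linear)
  qed (use C1 T u in auto)
qed


section \<open>Jung's theorem\<close>

text \<open>Here \<open>z\<close> is the circumcentre of \<open>T\<close> and \<open>C\<close> the hyperbolic cosine of its circumradius. Pairing the
  convex combination with \<open>hvec t\<close> gives \<open>C\<^sup>2 \<le> l t + (1 - l t) * cosh D\<close>, since the diagonal term is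
  \<open>l t\<close> and all other pairings are at most \<open>cosh D\<close>. Summing over \<open>T\<close> eliminates the weights.\<close>

lemma jung_bound:
  fixes T :: "'a::euclidean_space hyperbolic set"
  assumes T: "finite T" "card T \<le> n + 1" and l: "\<And>t. t \<in> T \<Longrightarrow> l t \<ge> 0" "sum l T = 1"
    and eq: "(\<Sum>t\<in>T. l t *\<^sub>R hvec t) = C *\<^sub>R hvec z"
    and C: "\<And>t. t \<in> T \<Longrightarrow> mink (hvec z) (hvec t) = C"
    and D: "D > 0" "\<And>s t. s \<in> T \<Longrightarrow> t \<in> T \<Longrightarrow> dist s t \<le> D"
  shows "C\<^sup>2 \<le> (1 + real n * cosh D) / (real n + 1)"
    and "C\<^sup>2 = (1 + real n * cosh D) / (real n + 1) \<Longrightarrow>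
      card T = n + 1 \<and> (\<forall>s\<in>T. \<forall>t\<in>T. s \<noteq> t \<longrightarrow> dist s t = D)"
proof -
  define c where "c = cosh D"
  define k where "k = real (card T)"
  have c1: "c > 1" using D cosh_real_strict_mono[of 0 D] by (simp add: c_def)
  have "T \<noteq> {}" using l by auto
  hence k: "k > 0" "k \<le> real n + 1" using T by (simp_all add: k_def card_gt_0_iff)
  have m: "mink (hvec s) (hvec t) \<le> c" if "s \<in> T" "t \<in> T" for s t
    using that D by (simp add: c_def flip: dist_le_iff_mink)
  \<comment> \<open>The slack in \<open>C\<^sup>2 \<le> l t + (1 - l t) * c\<close>, written as a sum of nonnegative terms.\<close>
  have gap: "(\<Sum>s\<in>T - {t}. l s * (c - mink (hvec s) (hvec t))) = c - l t * (c - 1) - C\<^sup>2"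
    if t: "t \<in> T" for t
  proof -
    have "C\<^sup>2 = mink (\<Sum>s\<in>T. l s *\<^sub>R hvec s) (hvec t)"
      using C[OF t] by (simp add: eq mink_linear power2_eq_square)
    hence "c * sum l T - C\<^sup>2 = (\<Sum>s\<in>T. l s * (c - mink (hvec s) (hvec t)))"
      by (simp add: mink_sum_left mink_scale_left algebra_simps sum_subtractf sum_distrib_left)
    also have "\<dots> = l t * (c - 1) + (\<Sum>s\<in>T - {t}. l s * (c - mink (hvec s) (hvec t)))"
      using t T by (simp add: sum.remove hvec_self)
    finally show ?thesis using l by simp
  qed
  have gap0: "(\<Sum>s\<in>T - {t}. l s * (c - mink (hvec s) (hvec t))) \<ge> 0" if t: "t \<in> T" for t
    using m l t by (intro sum_nonneg mult_nonneg_nonneg) auto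
  have total: "(\<Sum>t\<in>T. c - l t * (c - 1) - C\<^sup>2) = k * c - (c - 1) - k * C\<^sup>2"
    by (simp add: sum_subtractf k_def l flip: sum_distrib_right)
  have nn: "c - l t * (c - 1) - C\<^sup>2 \<ge> 0" if "t \<in> T" for t
    using gap[OF that] gap0[OF that] by simp
  have "k * C\<^sup>2 \<le> k * c - (c - 1)" using total nn sum_nonneg[of T "\<lambda>t. c - l t * (c - 1) - C\<^sup>2"] by simp
  hence Ck: "C\<^sup>2 \<le> c - (c - 1) / k" using k by (simp add: field_simps)
  have kn: "c - (c - 1) / k \<le> c - (c - 1) / (real n + 1)"
    using k c1 by (intro diff_left_mono divide_left_mono) auto
  have val: "c - (c - 1) / (real n + 1) = (1 + real n * cosh D) / (real n + 1)"
    by (simp add: c_def field_simps)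
  show "C\<^sup>2 \<le> (1 + real n * cosh D) / (real n + 1)" using Ck kn val by linarith
  \<comment> \<open>In the extremal case there is no slack for any \<open>t\<close>; then all weights equal \<open>1 / (n + 1)\<close>, and
    positive weights force every off-diagonal pairing to be \<open>cosh D\<close>.\<close>
  assume "C\<^sup>2 = (1 + real n * cosh D) / (real n + 1)"
  hence C2: "C\<^sup>2 = c - (c - 1) / (real n + 1)" using val by simp
  hence "(c - 1) / k = (c - 1) / (real n + 1)" using Ck kn by linarith
  hence kn1: "k = real n + 1" using c1 k by (simp add: field_simps)
  have "(\<Sum>t\<in>T. c - l t * (c - 1) - C\<^sup>2) = 0"
    unfolding total unfolding C2 kn1 by (simp add: field_simps)
  hence zero: "c - l t * (c - 1) - C\<^sup>2 = 0" if "t \<in> T" for t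
    using that nn T by (simp add: sum_nonneg_eq_0_iff)
  have lpos: "l t > 0" if "t \<in> T" for t
  proof -
    have "l t * (c - 1) = (c - 1) / (real n + 1)" using zero[OF that] C2 by simp
    hence "l t * (c - 1) > 0" using c1 by simp
    thus ?thesis using c1 by (simp add: zero_less_mult_iff)
  qed
  have "dist s t = D" if st: "s \<in> T" "t \<in> T" "s \<noteq> t" for s t
  proof -
    have "(\<Sum>s\<in>T - {t}. l s * (c - mink (hvec s) (hvec t))) = 0"
      using gap[OF st(2)] zero[OF st(2)] by simp
    hence "\<forall>s\<in>T - {t}. l s * (c - mink (hvec s) (hvec t)) = 0"
      using m l st T by (subst (asm) sum_nonneg_eq_0_iff) auto
    hence "l s * (c - mink (hvec s) (hvec t)) = 0" using st by blast
    thus ?thesis using lpos[OF st(1)] D by (simp add: dist_eq_iff_mink c_def)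
  qed
  thus "card T = n + 1 \<and> (\<forall>s\<in>T. \<forall>t\<in>T. s \<noteq> t \<longrightarrow> dist s t = D)"
    using kn1 by (auto simp: k_def)
qed

text \<open>The centre of a regular simplex is its normalised centroid.\<close>

lemma ex_centre_simplex:
  fixes V :: "'a::euclidean_space hyperbolic set"
  assumes V: "finite V" "card V = n + 1" "\<forall>x\<in>V. \<forall>y\<in>V. x \<noteq> y \<longrightarrow> dist x y = D" and D: "D > 0"
  obtains z where
    "(\<Sum>v\<in>V. (1 / (real n + 1)) *\<^sub>R hvec v) = sqrt ((1 + real n * cosh D) / (real n + 1)) *\<^sub>R hvec z"
    "\<And>v. v \<in> V \<Longrightarrow> mink (hvec z) (hvec v) = sqrt ((1 + real n * cosh D) / (real n + 1))"
proof -
  define C where "C = sqrt ((1 + real n * cosh D) / (real n + 1))"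
  have "real n * cosh D \<ge> real n * 1" by (intro mult_left_mono) (simp_all add: cosh_real_ge_1)
  hence "(1 + real n * cosh D) / (real n + 1) \<ge> 1" by (simp add: field_simps)
  hence C1: "C \<ge> 1" and CC: "C * C = (1 + real n * cosh D) / (real n + 1)" by (simp_all add: C_def)
  define g where "g = (\<Sum>v\<in>V. (1 / (real n + 1)) *\<^sub>R hvec v)"
  have gv: "mink g (hvec v) = C * C" if v: "v \<in> V" for v
  proof -
    have "mink g (hvec v) = (1 / (real n + 1)) * (\<Sum>w\<in>V. mink (hvec w) (hvec v))"
      by (simp add: g_def mink_linear sum_distrib_left)
    also have "(\<Sum>w\<in>V. mink (hvec w) (hvec v)) = 1 + (\<Sum>w\<in>V - {v}. mink (hvec w) (hvec v))"
      using v V by (simp add: sum.remove hvec_self)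
    also have "(\<Sum>w\<in>V - {v}. mink (hvec w) (hvec v)) = (\<Sum>w\<in>V - {v}. cosh D)"
      using v V D by (intro sum.cong) (auto simp flip: dist_eq_iff_mink)
    also have "\<dots> = n * cosh D" using v V by simp
    finally show ?thesis by (simp add: CC)
  qed
  have gg: "mink g g = C * C"
    by (subst (2) g_def) (simp add: mink_sum_right mink_scale_right gv V field_simps)
  have "V \<noteq> {}" using V by auto
  then obtain v0 where v0: "v0 \<in> V" by blast
  obtain z where "hvec z = (1 / C) *\<^sub>R g"
    using hvec_surj[of "(1 / C) *\<^sub>R g" v0] C1 by (auto simp: mink_linear gg gv[OF v0])
  hence gz: "g = C *\<^sub>R hvec z" using C1 by simp
  show ?thesis
  proof (rule that[of z])
    show "mink (hvec z) (hvec v) = sqrt ((1 + real n * cosh D) / (real n + 1))" if "v \<in> V" for v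
      unfolding C_def[symmetric] using gv[OF that] C1 by (simp add: gz mink_linear)
  qed (use gz in \<open>simp add: g_def C_def\<close>)
qed


section \<open>Congruence of regular simplices\<close>

text \<open>The Gram matrix of the vertices has \<open>1\<close> on the diagonal and \<open>cosh D > 1\<close> elsewhere, hence is
  nonsingular.\<close>

lemma hvec_simplex_basis:
  fixes V :: "'a::euclidean_space hyperbolic set"
  assumes V: "finite V" "card V = DIM('a) + 1" "\<forall>x\<in>V. \<forall>y\<in>V. x \<noteq> y \<longrightarrow> dist x y = D" and D: "D > 0"
  shows "independent (hvec ` V)" and "span (hvec ` V) = UNIV"
proof -
  have inj: "inj_on hvec V" by (simp add: inj_on_def hvec_inject)
  define c where "c = cosh D"
  have c1: "c > 1" using D cosh_real_strict_mono[of 0 D] by (simp add: c_def)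
  show indep: "independent (hvec ` V)"
  proof (rule independent_if_scalars_zero)
    fix f p assume 0: "(\<Sum>x\<in>hvec ` V. f x *\<^sub>R x) = 0" and "p \<in> hvec ` V"
    then obtain w where w: "w \<in> V" "p = hvec w" by blast
    define a where "a = f \<circ> hvec"
    have 0: "(\<Sum>v\<in>V. a v *\<^sub>R hvec v) = 0" using 0 by (simp add: sum.reindex inj a_def)
    have eq: "(c - 1) * a v = c * sum a V" if v: "v \<in> V" for v
    proof -
      have "0 = mink (\<Sum>x\<in>V. a x *\<^sub>R hvec x) (hvec v)" by (simp add: 0)
      also have "\<dots> = (\<Sum>x\<in>V. a x * mink (hvec x) (hvec v))" by (simp add: mink_linear)
      also have "\<dots> = a v + (\<Sum>x\<in>V - {v}. a x * mink (hvec x) (hvec v))"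
        using v V by (simp add: sum.remove hvec_self)
      also have "(\<Sum>x\<in>V - {v}. a x * mink (hvec x) (hvec v)) = (\<Sum>x\<in>V - {v}. a x * c)"
        using v V D by (intro sum.cong) (auto simp: c_def simp flip: dist_eq_iff_mink)
      also have "\<dots> = (sum a V - a v) * c"
        using v V by (simp add: sum_diff1 flip: sum_distrib_right)
      finally show ?thesis by (simp add: algebra_simps)
    qed
    have "(c - 1) * sum a V = (\<Sum>v\<in>V. c * sum a V)"
      by (simp add: sum_distrib_left eq)
    hence "sum a V * (1 + DIM('a) * c) = 0" using V by (simp add: algebra_simps)
    moreover have "1 + DIM('a) * c > 0" using c1 by (intro add_pos_nonneg) auto
    ultimately have "sum a V = 0" by simp
    thus "f p = 0" using eq[OF w(1)] c1 w by (simp add: a_def)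
  qed (use V in simp)
  have "UNIV \<subseteq> span (hvec ` V)"
    using V by (intro card_ge_dim_independent indep) (simp_all add: card_image inj)
  thus "span (hvec ` V) = UNIV" by blast
qed

text \<open>Two systems of vertices are bases of the ambient space with the same Gram matrix; the linear map
  between them preserves the form, hence restricts to an isometry of hyperbolic space.\<close>

lemma ex_isometry_simplices:
  fixes V W :: "'a::euclidean_space hyperbolic set"
  assumes V: "finite V" "card V = DIM('a) + 1" "\<forall>x\<in>V. \<forall>y\<in>V. x \<noteq> y \<longrightarrow> dist x y = D"
    and W: "finite W" "card W = DIM('a) + 1" "\<forall>x\<in>W. \<forall>y\<in>W. x \<noteq> y \<longrightarrow> dist x y = D"
    and D: "D > 0"
  shows "\<exists>f. bij f \<and> (\<forall>x y. dist (f x) (f y) = dist x y) \<and> f ` V = W"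
proof -
  obtain b where b: "bij_betw b V W" using finite_same_card_bij V W by metis
  define h :: "'a hyperbolic \<Rightarrow> 'a \<times> real" where "h = hvec"
  have hinv: "inv h (h x) = x" for x by (simp add: h_def inj_def hvec_inject)
  have "\<exists>g. linear g \<and> (\<forall>p\<in>h ` V. g p = h (b (inv h p)))"
    by (rule linear_independent_extend) (simp add: h_def hvec_simplex_basis(1)[OF V D])
  then obtain g where g: "linear g" "\<forall>p\<in>h ` V. g p = h (b (inv h p))" by blast
  have gv: "g (hvec v) = hvec (b v)" if "v \<in> V" for v
    using g(2) that hinv by (simp add: h_def)
  have bil: "bilinear (\<lambda>p q. mink p q)" "bilinear (\<lambda>p q. mink (g p) (g q))"
    unfolding bilinear_def
    by (intro conjI allI linearI;
        simp add: mink_linear linear_add[OF g(1)] linear_scale[OF g(1)])+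
  have gm: "mink (g p) (g q) = mink p q" for p q
  proof (rule bilinear_eq[OF bil(2,1)])
    show "UNIV \<subseteq> span (hvec ` V)" "UNIV \<subseteq> span (hvec ` V)"
      using hvec_simplex_basis(2)[OF V D] by simp_all
    fix p q assume "p \<in> hvec ` V" "q \<in> hvec ` V"
    then obtain x y where xy: "x \<in> V" "y \<in> V" "p = hvec x" "q = hvec y" by blast
    have "dist (b x) (b y) = dist x y"
    proof (cases "x = y")
      case False
      hence "b x \<noteq> b y" using b xy by (metis bij_betw_imp_inj_on inj_onD)
      moreover have "b x \<in> W" "b y \<in> W" using b xy by (simp_all add: bij_betw_apply)
      ultimately show ?thesis using V(3) W(3) xy False by metis
    qed simp
    hence "mink (hvec (b x)) (hvec (b y)) = mink (hvec x) (hvec y)"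
      by (metis cosh_dist_hyperbolic)
    thus "mink (g p) (g q) = mink p q" by (simp only: xy gv)
  qed auto
  have "V \<noteq> {}" using V by auto
  then obtain v0 where v0: "v0 \<in> V" by blast
  have pos: "mink (g (hvec y)) (hvec (b v0)) > 0" for y
    using mink_hvec_ge_1[of y v0] by (simp add: gm flip: gv[OF v0])
  have "\<exists>x. hvec x = g (hvec y)" for y
    using hvec_surj[OF _ pos] by (simp add: gm hvec_self)
  then obtain f where f: "\<And>y. hvec (f y) = g (hvec y)" by metis
  have iso: "dist (f x) (f y) = dist x y" for x y
    by (simp add: dist_hyperbolic_def f gm)
  have inj: "inj f" by (rule injI) (metis iso dist_eq_0_iff)
  have fv: "f v = b v" if "v \<in> V" for v
    using f[of v] gv[OF that] by (simp add: hvec_inject)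
  have "surj f"
    unfolding surj_def
  proof
    fix y
    have "hvec y \<in> span (hvec ` W)" using hvec_simplex_basis(2)[OF W D] by simp
    also have "hvec ` W = g ` hvec ` V"
      unfolding bij_betw_imp_surj_on[OF b, symmetric]
      by (simp add: image_image gv cong: image_cong_simp)
    also have "span (g ` hvec ` V) = g ` span (hvec ` V)" by (rule linear_span_image[OF g(1)])
    finally obtain p where p: "hvec y = g p" by blast
    have "mink p p = 1" using gm[of p p] by (simp add: hvec_self flip: p)
    moreover have "mink p (hvec v0) > 0"
      using gm[of p "hvec v0"] mink_hvec_ge_1[of y "b v0"] by (simp add: gv[OF v0] flip: p)
    ultimately obtain x where "hvec x = p" using hvec_surj by blast
    hence "hvec y = hvec (f x)" using p f[of x] by simp
    hence "y = f x" by (simp only: hvec_inject)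
    thus "\<exists>x. y = f x" by blast
  qed
  moreover have "f ` V = W" using b fv by (auto simp: bij_betw_def)
  ultimately show ?thesis using inj iso by (auto simp: bij_def)
qed

lemma isometric_image_hull_subset:
  assumes f: "\<And>x y. dist (f x) (f y) = dist x y"
    and K: "geodesic_convex K" "f ` V \<subseteq> K"
  shows "f ` (geodesic_convex hull V) \<subseteq> K"
proof -
  have "geodesic_convex (f -` K)"
    unfolding geodesic_convex_def
  proof (intro ballI subsetI)
    fix x y z assume "x \<in> f -` K" "y \<in> f -` K" "z \<in> {z. dist x z + dist z y = dist x y}"
    hence "f x \<in> K" "f y \<in> K" "dist (f x) (f z) + dist (f z) (f y) = dist (f x) (f y)"
      by (simp_all add: f)
    thus "z \<in> f -` K" using K(1) unfolding geodesic_convex_def by blast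
  qed
  hence "geodesic_convex hull V \<subseteq> f -` K" using K by (intro hull_minimal) auto
  thus ?thesis by blast
qed


section \<open>Inradius and circumradius of complete sets\<close>

theorem corollary8p4:
  fixes K \<Delta> :: "'a::euclidean_space hyperbolic set" and D :: real
  assumes "DIM('a) \<ge> 2"
    and "diam_complete K"
    and "diameter K = D"
    and "D > 0"
    and "regular_simplex D \<Delta>"
  shows "circumradius K \<le> circumradius \<Delta>
    \<and> inradius K \<ge> D - circumradius \<Delta>
    \<and> ((circumradius K = circumradius \<Delta> \<or> inradius K = D - circumradius \<Delta>)
         \<longleftrightarrow> (\<exists>\<Delta>'. isometric_image \<Delta> \<Delta>' \<and> \<Delta>' \<subseteq> K))"
proof -
  note K = assms(2,3,4)
  have D: "D > 0" by fact
  define n where "n = DIM('a)"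
  define Cn where "Cn = sqrt ((1 + real n * cosh D) / (real n + 1))"
  have Cn2: "Cn\<^sup>2 = (1 + real n * cosh D) / (real n + 1)"
    unfolding Cn_def using cosh_real_ge_1[of D] by (simp add: add_nonneg_nonneg)
  have "real n * cosh D \<ge> real n * 1" by (intro mult_left_mono) (simp_all add: cosh_real_ge_1)
  hence "(1 + real n * cosh D) / (real n + 1) \<ge> 1" by (simp add: field_simps)
  hence Cn1: "Cn \<ge> 1" by (simp add: Cn_def)
  obtain V where V: "finite V" "card V = n + 1" "\<forall>x\<in>V. \<forall>y\<in>V. x \<noteq> y \<longrightarrow> dist x y = D"
    and hull: "\<Delta> = geodesic_convex hull V"
    using assms(5) by (auto simp: regular_simplex_def n_def)

  have circ_simplex: "circumradius \<Delta> = arcosh Cn"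
  proof -
    obtain z where z: "(\<Sum>v\<in>V. (1 / (real n + 1)) *\<^sub>R hvec v) = Cn *\<^sub>R hvec z"
      "\<And>v. v \<in> V \<Longrightarrow> mink (hvec z) (hvec v) = Cn"
      by (rule ex_centre_simplex[OF V D, folded Cn_def]) (rule that)
    have "V \<subseteq> cball z (arcosh Cn)"
      using Cn1 by (auto simp: dist_le_iff_mink z)
    hence "\<Delta> \<subseteq> cball z (arcosh Cn)"
      unfolding hull by (intro hull_minimal geodesic_convex_cball)
    thus ?thesis
      using V Cn1 z hull_subset[of V geodesic_convex] unfolding hull
      by (intro circumradius_eqI[of V _ "\<lambda>_. 1 / (real n + 1)"]) auto
  qed

  obtain x0 where x0: "x0 \<in> K" using ex_two_points[of K] K by fastforce
  hence "K \<noteq> {}" by blast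
  then obtain z C T l where C: "C \<ge> 1" and T: "finite T" "T \<subseteq> K" "card T \<le> n + 1"
    and l: "\<And>t. t \<in> T \<Longrightarrow> l t \<ge> 0" "sum l T = 1" "(\<Sum>t\<in>T. l t *\<^sub>R hvec t) = C *\<^sub>R hvec z"
    and zT: "\<And>t. t \<in> T \<Longrightarrow> mink (hvec z) (hvec t) = C"
    and zK: "\<And>x. x \<in> K \<Longrightarrow> mink (hvec z) (hvec x) \<le> C"
    by (rule ex_circumcentre[OF _ compact_hvec_complete[OF K], folded n_def]) (rule that)
  have cov: "K \<subseteq> cball z (arcosh C)" using C zK by (auto simp: dist_le_iff_mink)
  have circ: "circumradius K = arcosh C" by (rule circumradius_eqI[OF T(1,2) l(1,2) C l(3) cov])
  have least: "arcosh C \<le> R" if "K \<subseteq> cball w R" for w R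
    using covering_radius_ge[OF T(1) _ l(1,2) C l(3), of w R] T that by blast
  have TD: "dist s t \<le> D" if "s \<in> T" "t \<in> T" for s t
    using that T diam_complete_iff_cball[OF K] by blast
  note jung = jung_bound[OF T(1,3) l zT D TD]
  have "C\<^sup>2 \<le> Cn\<^sup>2" using jung(1) Cn2 by simp
  hence CCn: "C \<le> Cn" by (rule power2_le_imp_le) (use Cn1 in simp)
  hence "cosh (arcosh C) \<le> cosh (arcosh Cn)" using C Cn1 by simp
  hence "arcosh C \<le> arcosh Cn" using C Cn1 by (subst (asm) cosh_real_nonneg_le_iff) auto
  hence le: "circumradius K \<le> circumradius \<Delta>" by (simp only: circ circ_simplex)

  have inr: "inradius K = D - circumradius K"
    unfolding inradius_def circ
  proof (rule Greatest_equality)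
    have "K \<subseteq> cball x0 D"
      by (subst diam_complete_eq_Inter[OF K]) (use x0 in blast)
    hence "arcosh C \<le> D" by (rule least)
    hence "D - arcosh C \<ge> 0" by simp
    thus "D - arcosh C \<ge> 0 \<and> (\<exists>z. cball z (D - arcosh C) \<subseteq> K)"
      using cov by (auto simp: cball_subset_complete_iff[OF K])
  next
    fix r assume "r \<ge> 0 \<and> (\<exists>z. cball z r \<subseteq> K)"
    then obtain w where "K \<subseteq> cball w (D - r)" using cball_subset_complete_iff[OF K] by blast
    hence "arcosh C \<le> D - r" by (rule least)
    thus "r \<le> D - arcosh C" by simp
  qed

  have "circumradius K = circumradius \<Delta> \<longleftrightarrow> (\<exists>\<Delta>'. isometric_image \<Delta> \<Delta>' \<and> \<Delta>' \<subseteq> K)"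
  proof
    assume "circumradius K = circumradius \<Delta>"
    hence "C = Cn" using C Cn1 by (metis circ circ_simplex cosh_arcosh_real)
    hence W: "card T = n + 1" "\<forall>s\<in>T. \<forall>t\<in>T. s \<noteq> t \<longrightarrow> dist s t = D"
      using jung(2) Cn2 by auto
    obtain f where f: "bij f" "\<And>x y. dist (f x) (f y) = dist x y" "f ` V = T"
      using ex_isometry_simplices[of V D T] V T(1) W D unfolding n_def by blast
    \<comment> \<open>\<open>K\<close> is an intersection of balls.\<close>
    have "geodesic_convex K"
      by (subst diam_complete_eq_Inter[OF K])
        (rule geodesic_convex_Inter, auto intro: geodesic_convex_cball)
    hence "f ` \<Delta> \<subseteq> K"
      unfolding hull using f T by (intro isometric_image_hull_subset) auto
    thus "\<exists>\<Delta>'. isometric_image \<Delta> \<Delta>' \<and> \<Delta>' \<subseteq> K"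
      using f unfolding isometric_image_def by blast
  next
    assume "\<exists>\<Delta>'. isometric_image \<Delta> \<Delta>' \<and> \<Delta>' \<subseteq> K"
    then obtain f where f: "bij f" "\<And>x y. dist (f x) (f y) = dist x y" "f ` \<Delta> \<subseteq> K"
      unfolding isometric_image_def by blast
    define W where "W = f ` V"
    have "inj_on f V" using f(1) by (auto simp: bij_def intro: inj_on_subset)
    hence W: "finite W" "card W = n + 1" "\<forall>x\<in>W. \<forall>y\<in>W. x \<noteq> y \<longrightarrow> dist x y = D"
      using V f(2) by (auto simp: W_def card_image)
    have WK: "W \<subseteq> K" using f(3) hull_subset[of V geodesic_convex] by (auto simp: W_def hull)
    obtain w where w: "(\<Sum>v\<in>W. (1 / (real n + 1)) *\<^sub>R hvec v) = Cn *\<^sub>R hvec w"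
      by (rule ex_centre_simplex[OF W D, folded Cn_def]) (rule that)
    have "arcosh Cn \<le> arcosh C"
      by (rule covering_radius_ge[OF W(1) _ _ _ Cn1 w, of z]) (use W WK cov in auto)
    thus "circumradius K = circumradius \<Delta>" using le by (simp add: circ circ_simplex)
  qed
  thus ?thesis using le inr by auto
qed

end
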